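(* Let $0<p<1$ and let $D_n$ denote the degree of the source (equivalently, of the sink) in a random series-parallel network of size $n$ generated by the Bernoulli model with parameter $p$. Then \[ \mathbb{P}\{D_n=m\}=\sum_{j=0}^{m-1}\binom{m-1}{j}(-1)^{n+j-1}\binom{p(j+1)-1}{n-1},\qquad 1\le m\le n . \] Moreover, as $n\to\infty$, \[ \frac{D_n}{n^{p}}\xrightarrow{(d)} D,\qquad D\stackrel{(d)}{=}\text{Mittag-Leffler}(p). \]
   Context: Bernoulli model (parameter $0<p<1$): a series-parallel network is a directed multigraph with two distinguished vertices, the source and the sink; its size is its number of edges. At step $1$ the network is a single edge from source to sink. At step $n\ge 2$ one of the $n-1$ edges of the current network, say $(x,y)$, is chosen uniformly at random; then independently, with probability $p$ it is doubled in parallel (an additional edge $(x,y)$ is added), and with probability $1-p$ it is doubled serially (the edge $(x,y)$ is replaced by edges $(x,z)$ and $(z,y)$, with $z$ a new node). The network after step $n$ is the random network of size $n$. For real $x$ and integer $k\ge0$, $\binom{x}{k}=x(x-1)\cdots(x-k+1)/k!$. A random variable $Y$ is Mittag-Leffler$(\alpha)$ distributed ($0<\alpha<1$) if $\mathbb{E}(Y^r)=\frac{r!}{\Gamma(r\alpha+1)}$ for all integers $r\ge0$ (these moments determine the distribution). *)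

theory Defs
  imports "HOL-Probability.Probability" "Graph_Theory.Digraph"
begin

text \<open>
  The distinguished vertices are stored with a directed multigraph. Vertices and edges are named
  by natural numbers; the names carry no meaning.
\<close>

record sp_network =
  net_graph :: "(nat, nat) pre_digraph"
  source :: nat
  sink :: nat

abbreviation edges :: "sp_network \<Rightarrow> nat set" where
  "edges N \<equiv> arcs (net_graph N)"

definition single_edge :: sp_network where
  "single_edge =
    \<lparr>net_graph = \<lparr>verts = {0, 1}, arcs = {0}, tail = (\<lambda>_. 0), head = (\<lambda>_. 1)\<rparr>,
     source = 0, sink = 1\<rparr>"

definition fresh :: "nat set \<Rightarrow> nat" where
  "fresh A = Suc (Max A)"

definition double_parallel :: "nat \<Rightarrow> sp_network \<Rightarrow> sp_network" where
  "double_parallel e N =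
    (let G = net_graph N; e' = fresh (arcs G) in
      N\<lparr>net_graph :=
        \<lparr>verts = verts G,
         arcs = insert e' (arcs G),
         tail = (tail G)(e' := tail G e),
         head = (head G)(e' := head G e)\<rparr>\<rparr>)"

text \<open>
  In a serial doubling of an edge from \<open>x\<close> to \<open>y\<close>, the name \<open>e\<close> is reused for the edge from
  \<open>x\<close> to the new vertex \<open>z\<close>, and \<open>e'\<close> is the edge from \<open>z\<close> to \<open>y\<close>.
\<close>

definition double_serial :: "nat \<Rightarrow> sp_network \<Rightarrow> sp_network" where
  "double_serial e N =
    (let G = net_graph N; e' = fresh (arcs G); z = fresh (verts G) in
      N\<lparr>net_graph :=
        \<lparr>verts = insert z (verts G),
         arcs = insert e' (arcs G),
         tail = (tail G)(e' := z),
         head = (head G)(e := z, e' := head G e)\<rparr>\<rparr>)"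

definition bernoulli_step :: "real \<Rightarrow> sp_network \<Rightarrow> sp_network pmf" where
  "bernoulli_step p N =
    do {
      e \<leftarrow> pmf_of_set (edges N);
      b \<leftarrow> bernoulli_pmf p;
      return_pmf (if b then double_parallel e N else double_serial e N)
    }"

text \<open>
  The random network of size \<open>n \<ge> 1\<close>; size \<open>0\<close> is a dummy case, with the same value as size \<open>1\<close>.
\<close>

definition bernoulli_network :: "real \<Rightarrow> nat \<Rightarrow> sp_network pmf" where
  "bernoulli_network p n =
    ((\<lambda>X. bind_pmf X (bernoulli_step p)) ^^ (n - 1)) (return_pmf single_edge)"

definition degree :: "(nat, nat) pre_digraph \<Rightarrow> nat \<Rightarrow> nat" where
  "degree G v = in_degree G v + out_degree G v"

definition source_degree :: "sp_network \<Rightarrow> nat" where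
  "source_degree N = degree (net_graph N) (source N)"

definition sink_degree :: "sp_network \<Rightarrow> nat" where
  "sink_degree N = degree (net_graph N) (sink N)"

text \<open>The predicate is on the law of a real random variable.\<close>

definition mittag_leffler :: "real \<Rightarrow> real measure \<Rightarrow> bool" where
  "mittag_leffler \<alpha> M \<longleftrightarrow>
    real_distribution M \<and>
    (\<forall>r::nat. has_bochner_integral M (\<lambda>y. y ^ r) (fact r / Gamma (real r * \<alpha> + 1)))"

end

theory Submission
  imports Defs "HOL-Real_Asymp.Real_Asymp"
begin

text \<open>
  No edge ever enters the source or leaves the sink, so a parallel doubling raises the degree \<open>D\<close>
  of a terminal by one exactly when the chosen edge is incident with it, and a serial doubling
  leaves \<open>D\<close> unchanged. Hence \<open>D\<close> is a Markov chain which, at size \<open>n\<close>, moves from \<open>d\<close> to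
  \<open>d + 1\<close> with probability \<open>p d / n\<close>, and the exact formula follows by induction on \<open>n\<close>; it is
  proved for all \<open>m \<ge> 1\<close>, where it gives \<open>0\<close> for \<open>m > n\<close>, so that the boundary needs no separate
  case. The rising factorial moments of order \<open>r\<close> get multiplied by \<open>1 + r p / n\<close> in each step;
  together with Euler's limit for \<open>\<Gamma>\<close> this shows that all moments of \<open>D / n\<^sup>p\<close> converge to those of
  the Mittag-Leffler law. These moments grow so slowly that they determine the characteristic
  function of a law, and the existence of a law with these moments comes for free from tightness.
\<close>

subsection \<open>The law of a terminal degree\<close>

lemma fresh_notin: "finite A \<Longrightarrow> fresh A \<notin> A"
  by (metis Max_ge Suc_n_not_le_n fresh_def)

definition wf_network :: "nat \<Rightarrow> sp_network \<Rightarrow> bool" where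
  "wf_network n N \<longleftrightarrow>
     finite (edges N) \<and> card (edges N) = n \<and> n > 0 \<and> finite (verts (net_graph N)) \<and>
     source N \<in> verts (net_graph N) \<and> sink N \<in> verts (net_graph N) \<and>
     source N \<noteq> sink N \<and>
     (\<forall>e\<in>edges N. head (net_graph N) e \<noteq> source N \<and> tail (net_graph N) e \<noteq> sink N)"

lemma wf_network_single_edge: "wf_network 1 single_edge"
  by (simp add: wf_network_def single_edge_def)

lemma wf_network_double_parallel:
  assumes "wf_network n N" "e \<in> edges N"
  shows "wf_network (Suc n) (double_parallel e N)"
  using assms fresh_notin[of "edges N"]
  by (auto simp: wf_network_def double_parallel_def Let_def)

lemma wf_network_double_serial:
  assumes "wf_network n N" "e \<in> edges N"
  shows "wf_network (Suc n) (double_serial e N)"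
  using assms fresh_notin[of "edges N"] fresh_notin[of "verts (net_graph N)"]
  by (auto simp: wf_network_def double_serial_def Let_def)

text \<open>The degree function \<open>D\<close> serves as a tag for its terminal, so that source
  and sink are handled by one argument.\<close>

definition terminal_edges :: "(sp_network \<Rightarrow> nat) \<Rightarrow> sp_network \<Rightarrow> nat set" where
  "terminal_edges D N =
     (if D = source_degree then out_arcs (net_graph N) (source N)
      else in_arcs (net_graph N) (sink N))"

text \<open>By the invariant, one of the two summands of the degree counts an empty set.\<close>

lemma degree_eq_card_terminal_edges:
  assumes "wf_network n N" "D \<in> {source_degree, sink_degree}"
  shows "D N = card (terminal_edges D N)"
proof -
  have "in_arcs (net_graph N) (source N) = {}" "out_arcs (net_graph N) (sink N) = {}"
    using assms(1) by (auto simp: wf_network_def)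
  then show ?thesis
    using assms(2)
    by (auto simp: terminal_edges_def source_degree_def sink_degree_def degree_def
        in_degree_def out_degree_def)
qed

lemma terminal_edges_subset: "terminal_edges D N \<subseteq> edges N"
  by (auto simp: terminal_edges_def)

lemma degree_double_parallel:
  assumes wf: "wf_network n N" and e: "e \<in> edges N" and D: "D \<in> {source_degree, sink_degree}"
  shows "D (double_parallel e N) = (if e \<in> terminal_edges D N then Suc (D N) else D N)"
proof -
  have new: "fresh (edges N) \<notin> edges N"
    using wf by (simp add: wf_network_def fresh_notin)
  have "finite (terminal_edges D N)"
    using wf terminal_edges_subset[of D N] finite_subset by (auto simp: wf_network_def)
  moreover have "terminal_edges D (double_parallel e N) =
      (if e \<in> terminal_edges D N then insert (fresh (edges N)) (terminal_edges D N)
       else terminal_edges D N)"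
    using e new
    by (auto simp: terminal_edges_def double_parallel_def Let_def in_arcs_def out_arcs_def)
  moreover have "fresh (edges N) \<notin> terminal_edges D N"
    using new terminal_edges_subset by blast
  ultimately show ?thesis
    using degree_eq_card_terminal_edges[OF wf D]
      degree_eq_card_terminal_edges[OF wf_network_double_parallel[OF wf e] D]
    by simp
qed

lemma degree_double_serial:
  assumes wf: "wf_network n N" and e: "e \<in> edges N" and D: "D \<in> {source_degree, sink_degree}"
  shows "D (double_serial e N) = D N"
proof -
  have new: "fresh (edges N) \<notin> edges N" "fresh (verts (net_graph N)) \<noteq> source N"
      "fresh (verts (net_graph N)) \<noteq> sink N"
    using wf fresh_notin by (auto simp: wf_network_def) metis+
  have fin: "finite (terminal_edges D N)"
    using wf terminal_edges_subset[of D N] finite_subset by (auto simp: wf_network_def)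
  have "card (terminal_edges D (double_serial e N)) = card (terminal_edges D N)"
  \<comment> \<open>The only case in which the set changes: \<open>e\<close> entered the sink, is
    redirected to the new vertex, and the new edge takes its place. At the source nothing changes,
    because \<open>e\<close> keeps its tail.\<close>
  proof (cases "D \<noteq> source_degree \<and> head (net_graph N) e = sink N")
    case True
    then have *: "terminal_edges D (double_serial e N) =
        insert (fresh (edges N)) (terminal_edges D N - {e})" and "e \<in> terminal_edges D N"
      using e new
      by (auto simp: terminal_edges_def double_serial_def Let_def in_arcs_def)
    then show ?thesis
      using fin new(1) terminal_edges_subset[of D N] card.remove[of "terminal_edges D N" e]
      unfolding * by (subst card_insert_disjoint) (auto simp del: card_Diff_insert)
  next
    case False
    then have "terminal_edges D (double_serial e N) = terminal_edges D N"
      using e new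
      by (auto simp: terminal_edges_def double_serial_def Let_def in_arcs_def out_arcs_def)
    then show ?thesis by simp
  qed
  then show ?thesis
    using degree_eq_card_terminal_edges[OF wf D]
      degree_eq_card_terminal_edges[OF wf_network_double_serial[OF wf e] D]
    by simp
qed

lemma set_pmf_bernoulli_step:
  assumes "wf_network n N"
  shows "set_pmf (bernoulli_step p N) \<subseteq> {N'. wf_network (Suc n) N'}"
proof -
  have "finite (edges N)" "edges N \<noteq> {}"
    using assms by (auto simp: wf_network_def)
  then show ?thesis
    using assms
    by (auto simp: bernoulli_step_def set_bind_pmf set_pmf_of_set
        intro!: wf_network_double_parallel wf_network_double_serial split: if_splits)
qed

lemma bernoulli_network_Suc_Suc:
  "bernoulli_network p (Suc (Suc k)) =
     bind_pmf (bernoulli_network p (Suc k)) (bernoulli_step p)"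
  by (simp add: bernoulli_network_def)

lemma set_pmf_bernoulli_network:
  "set_pmf (bernoulli_network p (Suc k)) \<subseteq> {N. wf_network (Suc k) N}"
proof (induction k)
  case 0
  then show ?case using wf_network_single_edge by (simp add: bernoulli_network_def)
next
  case (Suc k)
  then show ?case
    unfolding bernoulli_network_Suc_Suc using set_pmf_bernoulli_step
    by (fastforce simp: set_bind_pmf)
qed

section \<open>Reduction to a Markov chain of degrees\<close>

lemma bool_pmf_eqI:
  assumes "pmf P True = pmf Q True"
  shows "P = Q"
proof (rule pmf_eqI)
  show "pmf P b = pmf Q b" for b
    using assms by (cases b) (auto simp: pmf_False_conv_True)
qed

lemma map_pmf_degree_bernoulli_step:
  assumes wf: "wf_network n N" and D: "D \<in> {source_degree, sink_degree}"
    and p: "0 \<le> p" "p \<le> 1"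
  shows "map_pmf D (bernoulli_step p N) =
    map_pmf (\<lambda>b. if b then Suc (D N) else D N) (bernoulli_pmf (p * real (D N) / real n))"
proof -
  let ?A = "terminal_edges D N"
  have fin: "finite (edges N)" "edges N \<noteq> {}" and n: "card (edges N) = n" "n > 0"
    using wf by (auto simp: wf_network_def)
  have DA: "D N = card ?A" and A: "?A \<subseteq> edges N"
    using degree_eq_card_terminal_edges[OF wf D] terminal_edges_subset by auto
  \<comment> \<open>The parameter has to lie in \<open>[0, 1]\<close>, since
    \<open>bernoulli_pmf\<close> has it as success probability only there.\<close>
  have "card ?A \<le> n" using A n fin card_mono by blast
  then have "p * real (D N) \<le> 1 * real n"
    unfolding DA using p by (intro mult_mono) auto
  then have bd: "0 \<le> p * real (D N) / real n" "p * real (D N) / real n \<le> 1"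
    using p n by auto
  \<comment> \<open>\<open>?Q\<close> is the law of the event that the doubling is parallel and hits
    an edge at the terminal; the new degree depends on nothing else.\<close>
  let ?Q = "bind_pmf (pmf_of_set (edges N)) (\<lambda>e. map_pmf (\<lambda>b. b \<and> e \<in> ?A) (bernoulli_pmf p))"
  have "{b. b} = {True}" by auto
  then have "pmf (map_pmf (\<lambda>b. b \<and> e \<in> ?A) (bernoulli_pmf p)) True = (if e \<in> ?A then p else 0)" for e
    using p by (auto simp: pmf_map vimage_def measure_pmf_single)
  then have "pmf ?Q True = (\<Sum>e\<in>edges N. if e \<in> ?A then p else 0) / real (card (edges N))"
    using fin by (simp add: pmf_bind integral_pmf_of_set)
  also have "\<dots> = p * real (D N) / real n"
    using fin A by (simp add: sum.If_cases DA n Int_absorb1)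
  finally have Q: "?Q = bernoulli_pmf (p * real (D N) / real n)"
    using bd by (intro bool_pmf_eqI) simp
  have "map_pmf D (bernoulli_step p N) =
      bind_pmf (pmf_of_set (edges N)) (\<lambda>e. bind_pmf (bernoulli_pmf p)
        (\<lambda>b. return_pmf (if b \<and> e \<in> ?A then Suc (D N) else D N)))"
    unfolding bernoulli_step_def map_bind_pmf map_return_pmf
    using fin degree_double_parallel[OF wf _ D] degree_double_serial[OF wf _ D]
    by (intro bind_pmf_cong refl arg_cong[where f = return_pmf]) auto
  also have "\<dots> = map_pmf (\<lambda>b. if b then Suc (D N) else D N) ?Q"
    by (simp add: map_bind_pmf map_pmf_comp) (simp add: map_pmf_def)
  finally show ?thesis unfolding Q .
qed

text \<open>The index is shifted: \<open>degree_law p k\<close> is the law of the degree at size \<open>Suc k\<close>.\<close>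

primrec degree_law :: "real \<Rightarrow> nat \<Rightarrow> nat pmf" where
  "degree_law p 0 = return_pmf 1"
| "degree_law p (Suc k) = bind_pmf (degree_law p k)
     (\<lambda>d. map_pmf (\<lambda>b. if b then Suc d else d) (bernoulli_pmf (p * real d / real (Suc k))))"

text \<open>The law of the next degree depends on the network only through its present degree and
  its size, so the image of the network process under \<open>D\<close> is again a Markov
  chain.\<close>

lemma map_pmf_degree_bernoulli_network:
  assumes D: "D \<in> {source_degree, sink_degree}" and p: "0 \<le> p" "p \<le> 1"
  shows "map_pmf D (bernoulli_network p (Suc k)) = degree_law p k"
proof (induction k)
  case 0
  have "terminal_edges D single_edge = {0}"
    using D by (auto simp: terminal_edges_def single_edge_def in_arcs_def out_arcs_def)
  then show ?case
    using degree_eq_card_terminal_edges[OF wf_network_single_edge D]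
    by (simp add: bernoulli_network_def)
next
  case (Suc k)
  have "map_pmf D (bernoulli_network p (Suc (Suc k))) =
      bind_pmf (bernoulli_network p (Suc k)) (\<lambda>N. map_pmf D (bernoulli_step p N))"
    by (simp add: bernoulli_network_Suc_Suc map_bind_pmf)
  also have "\<dots> = bind_pmf (bernoulli_network p (Suc k)) (\<lambda>N.
      map_pmf (\<lambda>b. if b then Suc (D N) else D N)
        (bernoulli_pmf (p * real (D N) / real (Suc k))))"
    using set_pmf_bernoulli_network
    by (intro bind_pmf_cong refl map_pmf_degree_bernoulli_step[OF _ D p]) auto
  also have "\<dots> = degree_law p (Suc k)"
    by (simp add: Suc.IH[symmetric] bind_map_pmf)
  finally show ?case .
qed

text \<open>The upper bound keeps the transition probabilities in \<open>[0, 1]\<close>; finiteness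
  of the support makes every function integrable.\<close>

lemma set_pmf_degree_law: "set_pmf (degree_law p k) \<subseteq> {1..Suc k}"
proof (induction k)
  case (Suc k)
  then show ?case by (fastforce simp: set_bind_pmf split: if_splits)
qed simp

text \<open>The transition of the chain acting on test functions. Indicators give the recursion for
  the probabilities, rising factorials the one for the moments.\<close>

lemma expectation_degree_law_Suc:
  fixes f :: "nat \<Rightarrow> real"
  assumes p: "0 \<le> p" "p \<le> 1"
  shows "measure_pmf.expectation (degree_law p (Suc k)) f =
    measure_pmf.expectation (degree_law p k)
      (\<lambda>d. f d + p * real d / real (Suc k) * (f (Suc d) - f d))"
proof -
  have bd: "p * real d / real (Suc k) \<in> {0..1}" if "d \<in> {1..Suc k}" for d
  proof -
    have "p * real d \<le> 1 * real (Suc k)" using that p by (intro mult_mono) auto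
    then show ?thesis using p by auto
  qed
  obtain A where A: "finite A" "set_pmf (degree_law p k) \<subseteq> A" "A \<subseteq> {1..Suc k}"
    using set_pmf_degree_law[of p k] by blast
  have "measure_pmf.expectation (degree_law p (Suc k)) f =
      (\<Sum>d\<in>A. pmf (degree_law p k) d *
        (f d + p * real d / real (Suc k) * (f (Suc d) - f d)))"
    unfolding degree_law.simps
  proof (subst pmf_expectation_bind[OF A(1) _ A(2)], simp, intro sum.cong refl)
    fix d assume "d \<in> A"
    then have "p * real d / real (Suc k) \<in> {0..1}" using bd A(3) by blast
    moreover have "measure_pmf.expectation (map_pmf (\<lambda>b. if b then Suc d else d)
        (bernoulli_pmf q)) f = f d + q * (f (Suc d) - f d)" if "q \<in> {0..1}" for q
      using that by (simp add: algebra_simps)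
    ultimately have "measure_pmf.expectation (map_pmf (\<lambda>b. if b then Suc d else d)
        (bernoulli_pmf (p * real d / real (Suc k)))) f =
      f d + p * real d / real (Suc k) * (f (Suc d) - f d)"
      by blast
    then show "pmf (degree_law p k) d *\<^sub>R measure_pmf.expectation
        (map_pmf (\<lambda>b. if b then Suc d else d) (bernoulli_pmf (p * real d / real (Suc k)))) f =
      pmf (degree_law p k) d * (f d + p * real d / real (Suc k) * (f (Suc d) - f d))"
      by simp
  qed
  also have "\<dots> = measure_pmf.expectation (degree_law p k)
      (\<lambda>d. f d + p * real d / real (Suc k) * (f (Suc d) - f d))"
    using A by (subst integral_measure_pmf[of A]) auto
  finally show ?thesis .
qed

subsection \<open>Exact distribution and moments\<close>

lemma integrable_degree_law [simp]:
  "integrable (measure_pmf (degree_law p k)) (f :: nat \<Rightarrow> real)"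
  using set_pmf_degree_law finite_subset by (intro integrable_measure_pmf_finite) blast

lemma pmf_degree_law_Suc:
  assumes "0 \<le> p" "p \<le> 1"
  shows "pmf (degree_law p (Suc k)) (Suc m) =
    pmf (degree_law p k) (Suc m) * (1 - p * real (Suc m) / real (Suc k)) +
    pmf (degree_law p k) m * (p * real m / real (Suc k))"
proof -
  have pmf_eq: "pmf P d = measure_pmf.expectation P (\<lambda>x. of_bool (x = d))" for P and d :: nat
  proof -
    have "pmf P d = measure_pmf.expectation P (indicator {d})"
      by (simp add: measure_pmf_single)
    also have "indicator {d} = (\<lambda>x. of_bool (x = d) :: real)"
      by (auto simp: indicator_def)
    finally show ?thesis .
  qed
  have "(\<lambda>d. of_bool (d = Suc m) + p * real d / real (Suc k) *
           (of_bool (Suc d = Suc m) - of_bool (d = Suc m))) =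
        (\<lambda>d. of_bool (d = Suc m) * (1 - p * real (Suc m) / real (Suc k)) +
           of_bool (d = m) * (p * real m / real (Suc k)))"
    by (auto simp: fun_eq_iff)
  then show ?thesis
    unfolding pmf_eq expectation_degree_law_Suc[OF assms] by simp
qed

text \<open>For fixed \<open>j\<close>, the function \<open>m \<mapsto> (m choose j)\<close> is an
  eigenvector of the transition of probabilities, with eigenvalue
  \<open>1 - p (j + 1) / (k + 1)\<close>. The formula expands the initial law in these eigenvectors,
  and the generalized binomial coefficient with its sign is the product of the eigenvalues.\<close>

lemma pmf_degree_law:
  assumes "0 \<le> p" "p \<le> 1"
  shows "pmf (degree_law p k) (Suc m) =
    (\<Sum>j\<le>m. real (m choose j) * (-1) ^ (k + j) * ((p * (real j + 1) - 1) gchoose k))"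
proof (induction k arbitrary: m)
  case 0
  \<comment> \<open>For \<open>k = 0\<close> only the alternating row sum of binomial coefficients
    is left; it vanishes unless \<open>m = 0\<close>, which matches the start in degree
    \<open>1\<close>.\<close>
  have "(\<Sum>j\<le>m. real (m choose j) * (-1) ^ j) = (if m = 0 then 1 else 0)"
    using choose_alternating_sum[of m, where ?'a = real] by (auto simp: mult.commute)
  then show ?case by (simp add: pmf_return)
next
  case (Suc k)
  define a where "a j = (-1) ^ (k + j) * ((p * (real j + 1) - 1) gchoose k)" for j
  \<comment> \<open>This is \<open>(k + 1) (x gchoose (k + 1)) = (x - k) (x gchoose k)\<close> at
    \<open>x = p (j + 1) - 1\<close>; the additional sign reverses the difference.\<close>
  have a_Suc: "(-1) ^ (Suc k + j) * ((p * (real j + 1) - 1) gchoose Suc k) =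
      a j * (1 - p * (real j + 1) / real (Suc k))" for j
  proof -
    have "real (Suc k) * (x gchoose Suc k) = (x - real k) * (x gchoose k)" for x :: real
      using gbinomial_mult_1[of x k] by (simp add: algebra_simps)
    from this[of "p * (real j + 1) - 1"]
    have "(p * (real j + 1) - 1) gchoose Suc k =
        (p * (real j + 1) - 1 - real k) * ((p * (real j + 1) - 1) gchoose k) / real (Suc k)"
      by (simp add: eq_divide_eq mult.commute del: of_nat_Suc)
    then have "(-1) ^ (Suc k + j) * ((p * (real j + 1) - 1) gchoose Suc k) =
        - a j * ((p * (real j + 1) - 1 - real k) / real (Suc k))"
      unfolding a_def by (simp del: of_nat_Suc)
    also have "(p * (real j + 1) - 1 - real k) / real (Suc k) = p * (real j + 1) / real (Suc k) - 1"
      by (simp add: field_simps)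
    finally show ?thesis by (simp only: right_diff_distrib)
  qed
  have IH: "pmf (degree_law p k) (Suc m) = (\<Sum>j\<le>m. real (m choose j) * a j)" for m
    by (simp add: Suc.IH a_def mult.assoc)
  \<comment> \<open>Absorption, \<open>m ((m - 1) choose j) = (m - j) (m choose j)\<close>, brings
    the contribution of the lower state to the same binomial coefficients. The sum can run up to
    \<open>j = m\<close>, where both sides are zero.\<close>
  have prev: "pmf (degree_law p k) m * real m = (\<Sum>j\<le>m. real (m choose j) * a j * (real m - real j))"
  proof (cases m)
    case (Suc m')
    have *: "real (Suc m') * real (m' choose j) = (real (Suc m') - real j) * real (Suc m' choose j)"
      if "j \<le> Suc m'" for j
    proof -
      have "(Suc m' - j) * (Suc m' choose j) = Suc m' * (m' choose j)"
        using binomial_absorb_comp[of "Suc m'" j] by simp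
      then have "real (Suc m' - j) * real (Suc m' choose j) = real (Suc m') * real (m' choose j)"
        by (metis of_nat_mult)
      with that show ?thesis by (simp add: of_nat_diff)
    qed
    have "pmf (degree_law p k) m * real m = (\<Sum>j\<le>Suc m'. real (Suc m') * real (m' choose j) * a j)"
      by (simp add: Suc IH sum_distrib_left sum_distrib_right mult_ac del: of_nat_Suc)
    also have "\<dots> = (\<Sum>j\<le>m. real (m choose j) * a j * (real m - real j))"
      unfolding Suc by (intro sum.cong refl) (simp only: * atMost_iff mult_ac)
    finally show ?thesis .
  qed simp
  have "pmf (degree_law p (Suc k)) (Suc m) =
      (\<Sum>j\<le>m. real (m choose j) * a j) * (1 - p * real (Suc m) / real (Suc k)) +
      (\<Sum>j\<le>m. real (m choose j) * a j * (real m - real j)) * (p / real (Suc k))"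
    unfolding pmf_degree_law_Suc[OF assms] prev[symmetric] IH by simp
  \<comment> \<open>Termwise, \<open>- p (m + 1) + p (m - j) = - p (j + 1)\<close>, so the
    dependence on \<open>m\<close> cancels from the factor.\<close>
  also have "\<dots> = (\<Sum>j\<le>m. real (m choose j) * (a j * (1 - p * (real j + 1) / real (Suc k))))"
  proof -
    have "c * b * (1 - p * (x + 1) / K) + c * b * (x - y) * (p / K) = c * (b * (1 - p * (y + 1) / K))"
      if "K \<noteq> 0" for b c x y K :: real
      using that by (simp add: field_simps)
    then show ?thesis
      unfolding sum_distrib_right sum.distrib[symmetric] of_nat_Suc[of m]
      by (intro sum.cong refl) (metis add.commute of_nat_Suc of_nat_eq_0_iff nat.distinct(1))
  qed
  finally show ?case
    unfolding mult.assoc a_Suc .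
qed

section \<open>Rising factorial moments and their asymptotics\<close>

text \<open>Rising factorials are eigenfunctions of the transition, unlike plain powers, so their
  expectations are explicit products. The start in degree \<open>1\<close> contributes
  \<open>fact r\<close>.\<close>

lemma expectation_pochhammer_degree_law:
  assumes "0 \<le> p" "p \<le> 1"
  shows "measure_pmf.expectation (degree_law p k) (\<lambda>d. pochhammer (real d) r) =
    fact r * pochhammer (1 + real r * p) k / fact k"
proof (induction k)
  case 0
  then show ?case by (simp add: pochhammer_fact)
next
  case (Suc k)
  \<comment> \<open>Both \<open>d * pochhammer (d + 1) r\<close> and
    \<open>(d + r) * pochhammer d r\<close> equal \<open>pochhammer d (r + 1)\<close>.\<close>
  have poch: "real d * (pochhammer (real (Suc d)) r - pochhammer (real d) r) =
      real r * pochhammer (real d) r" for d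
    using pochhammer_rec[of "real d" r] pochhammer_rec'[of "real d" r]
    by (simp add: algebra_simps)
  have "measure_pmf.expectation (degree_law p (Suc k)) (\<lambda>d. pochhammer (real d) r) =
      measure_pmf.expectation (degree_law p k) (\<lambda>d. pochhammer (real d) r +
        p / real (Suc k) * (real d * (pochhammer (real (Suc d)) r - pochhammer (real d) r)))"
    unfolding expectation_degree_law_Suc[OF assms] by (simp add: mult.assoc)
  also have "\<dots> = (1 + p * real r / real (Suc k)) *
      measure_pmf.expectation (degree_law p k) (\<lambda>d. pochhammer (real d) r)"
    unfolding poch by (simp add: algebra_simps del: of_nat_Suc)
  also have "\<dots> = fact r * pochhammer (1 + real r * p) (Suc k) / fact (Suc k)"
    unfolding Suc.IH by (simp add: pochhammer_rec' field_simps)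
  finally show ?case .
qed

text \<open>The reciprocal of Euler's product \<open>Gamma_series'\<close> at \<open>z + 1\<close>,
  up to a factor \<open>n / (n + z)\<close> that tends to \<open>1\<close>: its rising factorial has
  length \<open>n\<close>, one factor more than here.\<close>

lemma pochhammer_asymp:
  fixes z :: real
  assumes "z \<ge> 0"
  shows "(\<lambda>n. pochhammer (1 + z) (n - 1) / fact (n - 1) / real n powr z) \<longlonglongrightarrow> 1 / Gamma (z + 1)"
proof -
  have "z + 1 \<notin> \<int>\<^sub>\<le>\<^sub>0" using assms by (auto elim!: nonpos_Ints_cases)
  then have "Gamma (z + 1) \<noteq> 0" by (simp add: Gamma_eq_zero_iff)
  then have "(\<lambda>n. real n / (real n + z) / Gamma_series' (z + 1) n) \<longlonglongrightarrow> 1 / Gamma (z + 1)"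
    by (intro tendsto_divide Gamma_series'_LIMSEQ) real_asymp
  moreover have "\<forall>\<^sub>F n in sequentially. real n / (real n + z) / Gamma_series' (z + 1) n =
      pochhammer (1 + z) (n - 1) / fact (n - 1) / real n powr z"
    using eventually_gt_at_top[of 0]
  proof eventually_elim
    case (elim n)
    then obtain k where k: "n = Suc k" by (cases n) auto
    have pos: "pochhammer (1 + z) k > 0" using assms by (intro pochhammer_pos) auto
    have "exp ((z + 1) * ln (real n)) = real n powr z * real n"
      using elim by (simp add: powr_def algebra_simps exp_add)
    then have "Gamma_series' (z + 1) n =
        fact k * (real n powr z * real n) / (pochhammer (1 + z) k * (real n + z))"
      by (simp add: Gamma_series'_def k pochhammer_rec' algebra_simps)
    moreover have "a / b / (f * (q * a) / (c * b)) = c / f / q"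
      if "a > 0" "b > 0" "c > 0" "f > 0" "q > 0" for a b c f q :: real
      using that by (simp add: field_simps)
    moreover have "real n powr z > 0" "real n + z > 0" "real n > 0" "n - 1 = k"
      using elim assms k by auto
    ultimately show ?case
      using pos by (simp del: of_nat_Suc)
  qed
  ultimately show ?thesis by (rule Lim_transform_eventually)
qed

lemma power_le_pochhammer:
  fixes x :: real
  assumes "x \<ge> 0"
  shows "x ^ r \<le> pochhammer x r"
proof -
  have "(\<Prod>i<r. x) \<le> (\<Prod>i<r. x + real i)"
    using assms by (intro prod_mono) auto
  then show ?thesis by (simp add: pochhammer_prod atLeast0LessThan)
qed

text \<open>Together with \<open>power_le_pochhammer\<close> this encloses powers between rising
  factorials. The error is itself written as a rising factorial, of lower order, because its
  expectation is known.\<close>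

lemma pochhammer_Suc_le_power:
  obtains C where "\<And>x :: real. x \<ge> 0 \<Longrightarrow>
    pochhammer x (Suc r) \<le> x ^ Suc r + C * pochhammer x r"
proof -
  \<comment> \<open>This form reproduces itself under multiplication by \<open>x + r\<close>: the
    excess \<open>r * x ^ Suc r\<close> is absorbed by \<open>power_le_pochhammer\<close>. The
    difference between the factors \<open>x\<close> and \<open>x + r\<close> enters the constant at
    the end.\<close>
  have "\<exists>C. \<forall>x::real. x \<ge> 0 \<longrightarrow> pochhammer x r * x \<le> x ^ Suc r + C * pochhammer x r"
  proof (induction r)
    case 0
    show ?case by (intro exI[of _ 0]) auto
  next
    case (Suc r)
    then obtain C where C: "\<And>x::real. x \<ge> 0 \<Longrightarrow>
        pochhammer x r * x \<le> x ^ Suc r + C * pochhammer x r" by blast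
    have "pochhammer x (Suc r) * x \<le> x ^ Suc (Suc r) + (C + real r) * pochhammer x (Suc r)"
      if "x \<ge> 0" for x :: real
    proof -
      have "pochhammer x (Suc r) * x = pochhammer x r * x * (x + real r)"
        by (simp add: pochhammer_rec' algebra_simps)
      also have "\<dots> \<le> (x ^ Suc r + C * pochhammer x r) * (x + real r)"
        using that C by (intro mult_right_mono) auto
      also have "\<dots> = x ^ Suc (Suc r) + real r * x ^ Suc r + C * pochhammer x (Suc r)"
        by (simp add: pochhammer_rec' algebra_simps)
      also have "real r * x ^ Suc r \<le> real r * pochhammer x (Suc r)"
        using that by (intro mult_left_mono power_le_pochhammer) auto
      finally show ?thesis by (simp add: algebra_simps)
    qed
    then show ?case by blast
  qed
  then obtain C where C: "\<And>x::real. x \<ge> 0 \<Longrightarrow>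
      pochhammer x r * x \<le> x ^ Suc r + C * pochhammer x r" by blast
  have "pochhammer x (Suc r) \<le> x ^ Suc r + (C + real r) * pochhammer x r" if "x \<ge> 0" for x :: real
    using C[OF that] by (simp add: pochhammer_rec' algebra_simps)
  then show thesis using that by blast
qed

lemma moments_degree_law_tendsto:
  assumes p: "0 < p" "p \<le> 1"
  shows "(\<lambda>n. measure_pmf.expectation (degree_law p (n - 1)) (\<lambda>d. (real d / real n powr p) ^ r))
    \<longlonglongrightarrow> fact r / Gamma (real r * p + 1)"
proof -
  define E where "E n f = measure_pmf.expectation (degree_law p (n - 1)) f"
    for n and f :: "nat \<Rightarrow> real"
  have mono: "E n f \<le> E n g" if "\<And>d. f d \<le> g d" for n f g
    unfolding E_def using that by (intro integral_mono) auto
  have P: "(\<lambda>n. E n (\<lambda>d. pochhammer (real d) r) / real n powr (real r * p))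
      \<longlonglongrightarrow> fact r / Gamma (real r * p + 1)" for r
    using tendsto_mult_left[OF pochhammer_asymp[of "real r * p"], of "fact r"] p
    by (simp add: E_def expectation_pochhammer_degree_law mult.commute)
  have pow: "E n (\<lambda>d. (real d / real n powr p) ^ r) = E n (\<lambda>d. real d ^ r) / real n powr (real r * p)"
    if "n > 0" for n
    using that by (simp add: E_def power_divide powr_power mult.commute)
  have upper: "E n (\<lambda>d. real d ^ r) / real n powr (real r * p)
      \<le> E n (\<lambda>d. pochhammer (real d) r) / real n powr (real r * p)" for n
    by (intro divide_right_mono mono power_le_pochhammer) auto
  have "\<exists>L. (\<forall>n>0. L n \<le> E n (\<lambda>d. real d ^ r) / real n powr (real r * p)) \<and>
      L \<longlonglongrightarrow> fact r / Gamma (real r * p + 1)"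
  proof (cases r)
    case 0
    then show ?thesis by (intro exI[of _ "\<lambda>_. 1"]) (auto simp: E_def)
  next
    case (Suc s)
    obtain C where C: "\<And>x :: real. x \<ge> 0 \<Longrightarrow>
        pochhammer x (Suc s) \<le> x ^ Suc s + C * pochhammer x s"
      using pochhammer_Suc_le_power[of s] by blast
    \<comment> \<open>The correction has order \<open>s = r - 1\<close>; normalised by its own power
      of \<open>n\<close> it converges, and the factor \<open>n powr (- p)\<close> left over makes
      it vanish.\<close>
    define L where "L n = E n (\<lambda>d. pochhammer (real d) r) / real n powr (real r * p) -
        C * (E n (\<lambda>d. pochhammer (real d) s) / real n powr (real s * p)) * real n powr (- p)" for n
    have "L n \<le> E n (\<lambda>d. real d ^ r) / real n powr (real r * p)" if n: "n > 0" for n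
    proof -
      have "E n (\<lambda>d. pochhammer (real d) r) \<le> E n (\<lambda>d. real d ^ r + C * pochhammer (real d) s)"
        unfolding Suc by (intro mono C) auto
      also have "\<dots> = E n (\<lambda>d. real d ^ r) + C * E n (\<lambda>d. pochhammer (real d) s)"
        by (simp add: E_def)
      finally have "(E n (\<lambda>d. pochhammer (real d) r) - C * E n (\<lambda>d. pochhammer (real d) s)) /
          real n powr (real r * p) \<le> E n (\<lambda>d. real d ^ r) / real n powr (real r * p)"
        by (intro divide_right_mono) auto
      moreover have "real n powr (real r * p) = real n powr (real s * p) * real n powr p"
        by (simp add: Suc powr_add[symmetric] algebra_simps)
      ultimately show ?thesis
        using n by (simp add: L_def powr_minus field_simps)
    qed
    moreover have "L \<longlonglongrightarrow> fact r / Gamma (real r * p + 1) - C * (fact s / Gamma (real s * p + 1)) * 0"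
        unfolding L_def
    proof (intro tendsto_diff tendsto_mult tendsto_const P)
      show "(\<lambda>n. real n powr (- p)) \<longlonglongrightarrow> 0" using p by real_asymp
    qed
    ultimately show ?thesis by (intro exI[of _ L]) auto
  qed
  then obtain L where L: "\<And>n. n > 0 \<Longrightarrow> L n \<le> E n (\<lambda>d. real d ^ r) / real n powr (real r * p)"
      "L \<longlonglongrightarrow> fact r / Gamma (real r * p + 1)" by blast
  have "(\<lambda>n. E n (\<lambda>d. real d ^ r) / real n powr (real r * p)) \<longlonglongrightarrow> fact r / Gamma (real r * p + 1)"
    by (rule tendsto_sandwich[OF _ _ L(2) P[of r]])
      (auto intro!: eventually_sequentiallyI[of 1] L(1) upper)
  then show ?thesis
    unfolding E_def[symmetric]
    by (rule Lim_transform_eventually)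
      (auto intro!: eventually_sequentiallyI[of 1] simp: pow)
qed

subsection \<open>The method of moments\<close>

text \<open>Clipping changes \<open>y\<close> only where \<open>K < \<bar>y\<bar>\<close>, and there
  \<open>\<bar>y\<bar>\<close> is at most \<open>y\<^sup>2 / K\<close>. A bound on second moments
  thus makes the truncation error uniformly small over a family of laws.\<close>

lemma integral_clip_bound:
  fixes f :: "'a \<Rightarrow> real"
  assumes "integrable M f" "integrable M (\<lambda>x. (f x)\<^sup>2)" "K > 0"
  shows "\<bar>(\<integral>x. f x \<partial>M) - (\<integral>x. max (- K) (min (f x) K) \<partial>M)\<bar> \<le> (\<integral>x. (f x)\<^sup>2 \<partial>M) / K"
proof -
  have [measurable]: "f \<in> borel_measurable M" using assms(1) by simp
  have clip: "integrable M (\<lambda>x. max (- K) (min (f x) K))"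
    by (rule Bochner_Integration.integrable_bound[OF assms(1)]) (use \<open>K > 0\<close> in auto)
  have ptw: "\<bar>y - max (- K) (min y K)\<bar> \<le> y\<^sup>2 / K" for y :: real
  proof (cases "\<bar>y\<bar> \<le> K")
    case True
    then have "max (- K) (min y K) = y" by auto
    then show ?thesis using \<open>K > 0\<close> by simp
  next
    case False
    then have "K * \<bar>y\<bar> \<le> \<bar>y\<bar> * \<bar>y\<bar>" using \<open>K > 0\<close> by (intro mult_right_mono) auto
    then have "\<bar>y\<bar> \<le> y\<^sup>2 / K"
      using \<open>K > 0\<close> by (simp add: field_simps power2_eq_square)
    then show ?thesis using False \<open>K > 0\<close> by (auto simp: max_def min_def)
  qed
  have "\<bar>(\<integral>x. f x \<partial>M) - (\<integral>x. max (- K) (min (f x) K) \<partial>M)\<bar> =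
      \<bar>\<integral>x. f x - max (- K) (min (f x) K) \<partial>M\<bar>"
    using assms clip by simp
  also have "\<dots> \<le> (\<integral>x. \<bar>f x - max (- K) (min (f x) K)\<bar> \<partial>M)"
    by (rule integral_abs_bound)
  also have "\<dots> \<le> (\<integral>x. (f x)\<^sup>2 / K \<partial>M)"
    using assms clip ptw by (intro integral_mono) auto
  finally show ?thesis by simp
qed

text \<open>Weak convergence concerns bounded test functions only. Powers are clipped at level
  \<open>K\<close>, and the moments of order \<open>2 * r\<close> control the error uniformly in
  \<open>n\<close>.\<close>

lemma weak_conv_has_moments:
  assumes \<mu>: "\<And>n. real_distribution (\<mu> n)" and M: "real_distribution M"
    and conv: "weak_conv_m \<mu> M"
    and int: "\<And>n r. integrable (\<mu> n) (\<lambda>x. x ^ r)"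
    and lim: "\<And>r. (\<lambda>n. \<integral>x. x ^ r \<partial>\<mu> n) \<longlonglongrightarrow> m r"
  shows "has_bochner_integral M (\<lambda>x. x ^ r) (m r)"
proof -
  interpret M: real_distribution M by (rule M)
  interpret \<mu>: real_distribution "\<mu> n" for n by (rule \<mu>)
  note bdd_conv = weak_conv_imp_integral_bdd_continuous_conv[OF \<mu> M conv]
  have even: "integrable M (\<lambda>x. x ^ (2 * r)) \<and> (\<integral>x. x ^ (2 * r) \<partial>M) \<le> m (2 * r)" for r
  proof -
    \<comment> \<open>For each fixed truncation weak convergence applies; monotone convergence then
      removes the truncation. This yields integrability under \<open>M\<close>, but only an
      inequality for the moment.\<close>
    define f where "f i x = min (x ^ (2 * r)) (real i)" for i and x :: real
    have f_nonneg: "0 \<le> f i x" for i x by (simp add: f_def)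
    have f_cont: "isCont (f i) x" for i x unfolding f_def by (intro continuous_intros)
    have [measurable]: "f i \<in> borel_measurable borel" for i unfolding f_def by measurable
    have f_bdd: "norm (f i x) \<le> real i" for i x by (simp add: f_def)
    have f_int: "integrable N (f i)" if "real_distribution N" for N i
    proof -
      interpret N: real_distribution N by fact
      show ?thesis using f_bdd[of i] by (intro N.integrable_const_bound[of _ "real i"]) auto
    qed
    have f_le: "(\<integral>x. f i x \<partial>M) \<le> m (2 * r)" for i
    proof (rule LIMSEQ_le[OF bdd_conv lim])
      show "\<exists>N. \<forall>n\<ge>N. (\<integral>x. f i x \<partial>\<mu> n) \<le> (\<integral>x. x ^ (2 * r) \<partial>\<mu> n)"
        using f_int[OF \<mu>] int by (intro exI allI impI integral_mono) (auto simp: f_def)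
    qed (rule f_cont f_bdd)+
    have "(\<lambda>i. \<integral>\<^sup>+x. ennreal (f i x) \<partial>M) \<longlonglongrightarrow> (\<integral>\<^sup>+x. ennreal (x ^ (2 * r)) \<partial>M)"
    proof (rule nn_integral_LIMSEQ)
      show "incseq (\<lambda>i x. ennreal (f i x))"
        by (auto simp: incseq_def le_fun_def f_def intro!: ennreal_leI)
      show "(\<lambda>i. ennreal (f i x)) \<longlonglongrightarrow> ennreal (x ^ (2 * r))" for x
      proof (intro tendsto_ennrealI tendsto_eventually)
        obtain i0 :: nat where "x ^ (2 * r) \<le> real i0" using real_arch_simple by blast
        then show "\<forall>\<^sub>F i in sequentially. f i x = x ^ (2 * r)"
          by (intro eventually_sequentiallyI[of i0]) (auto simp: f_def min_def)
      qed
    qed simp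
    moreover have "(\<integral>\<^sup>+x. ennreal (f i x) \<partial>M) \<le> ennreal (m (2 * r))" for i
      using f_int[OF M] f_nonneg f_le by (subst nn_integral_eq_integral) (auto intro: ennreal_leI)
    ultimately have le: "(\<integral>\<^sup>+x. ennreal (x ^ (2 * r)) \<partial>M) \<le> ennreal (m (2 * r))"
      by (intro LIMSEQ_le_const2) auto
    have "0 \<le> m (2 * r)" using f_le[of 0] by (simp add: f_def)
    moreover have "integrable M (\<lambda>x. x ^ (2 * r))"
      using le by (intro integrableI_nonneg) (auto simp: top.not_eq_extremum intro: le_less_trans)
    ultimately show ?thesis using integral_real_bounded[OF _ le] by simp
  qed
  have int_M: "integrable M (\<lambda>x. x ^ r)"
  proof (rule Bochner_Integration.integrable_bound)
    show "integrable M (\<lambda>x. 1 + x ^ (2 * r))" using even by simp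
    have "\<bar>y\<bar> \<le> 1 + y\<^sup>2" for y :: real
    proof -
      have "0 \<le> (\<bar>y\<bar> - 1)\<^sup>2" by simp
      then show ?thesis by (simp add: power2_eq_square algebra_simps)
    qed
    then show "AE x in M. norm (x ^ r) \<le> norm (1 + x ^ (2 * r))"
      by (simp add: power_even_eq add_nonneg_nonneg)
  qed simp
  have sq: "(x ^ r)\<^sup>2 = x ^ (2 * r)" for x :: real by (simp add: power_even_eq)
  \<comment> \<open>One term \<open>m (2 * r) / K\<close> pays for clipping under
    \<open>\<mu> n\<close>, in the limit, the other for clipping under \<open>M\<close>. As
    \<open>K\<close> is arbitrary, the two moments agree.\<close>
  have "\<bar>m r - (\<integral>x. x ^ r \<partial>M)\<bar> \<le> 2 * m (2 * r) / K" if "K > 0" for K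
  proof -
    define g where "g x = max (- K) (min (x ^ r) K)" for x :: real
    have "(\<lambda>n. \<integral>x. g x \<partial>\<mu> n) \<longlonglongrightarrow> (\<integral>x. g x \<partial>M)"
      using that by (intro bdd_conv[where B = K]) (auto simp: g_def intro!: continuous_intros)
    then have "(\<lambda>n. \<bar>(\<integral>x. x ^ r \<partial>\<mu> n) - (\<integral>x. g x \<partial>\<mu> n)\<bar>) \<longlonglongrightarrow> \<bar>m r - (\<integral>x. g x \<partial>M)\<bar>"
      by (intro tendsto_intros lim)
    moreover have "(\<lambda>n. (\<integral>x. x ^ (2 * r) \<partial>\<mu> n) / K) \<longlonglongrightarrow> m (2 * r) / K"
      using that by (intro tendsto_intros lim) auto
    moreover have "\<bar>(\<integral>x. x ^ r \<partial>\<mu> n) - (\<integral>x. g x \<partial>\<mu> n)\<bar> \<le> (\<integral>x. x ^ (2 * r) \<partial>\<mu> n) / K" for n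
      using integral_clip_bound[OF int, of n r K] int[of n "2 * r"] that
      unfolding g_def sq by simp
    ultimately have "\<bar>m r - (\<integral>x. g x \<partial>M)\<bar> \<le> m (2 * r) / K"
      by (intro LIMSEQ_le) auto
    moreover have "\<bar>(\<integral>x. x ^ r \<partial>M) - (\<integral>x. g x \<partial>M)\<bar> \<le> (\<integral>x. x ^ (2 * r) \<partial>M) / K"
      using integral_clip_bound[OF int_M, of K] even that unfolding g_def sq by simp
    moreover have "(\<integral>x. x ^ (2 * r) \<partial>M) / K \<le> m (2 * r) / K"
      using even that by (intro divide_right_mono) auto
    ultimately show ?thesis by linarith
  qed
  then have "\<bar>m r - (\<integral>x. x ^ r \<partial>M)\<bar> \<le> 2 * m (2 * r) / real (Suc i)" for i
    by (metis of_nat_0_less_iff zero_less_Suc)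
  moreover have "(\<lambda>i. 2 * m (2 * r) / real (Suc i)) \<longlonglongrightarrow> 0"
    by (rule LIMSEQ_Suc[OF lim_const_over_n])
  ultimately have "\<bar>m r - (\<integral>x. x ^ r \<partial>M)\<bar> \<le> 0"
    by (intro LIMSEQ_le_const) auto
  then have "(\<integral>x. x ^ r \<partial>M) = m r" by simp
  then show ?thesis using int_M by (simp add: has_bochner_integral_iff)
qed

lemma tight_if_second_moments_bounded:
  assumes \<mu>: "\<And>n. real_distribution (\<mu> n)"
    and int: "\<And>n. integrable (\<mu> n) (\<lambda>x. x\<^sup>2)"
    and bdd: "\<And>n. (\<integral>x. x\<^sup>2 \<partial>\<mu> n) \<le> B"
  shows "tight \<mu>"
  unfolding tight_def
proof (intro conjI allI impI \<mu>)
  fix \<epsilon> :: real assume "\<epsilon> > 0"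
  \<comment> \<open>Chosen for Chebyshev's inequality: \<open>B / s\<^sup>2 < \<epsilon>\<close>,
    where the summand \<open>1\<close> makes the inequality strict and \<open>s\<close>
    positive.\<close>
  define s where "s = sqrt ((\<bar>B\<bar> + 1) / \<epsilon>)"
  have s: "s > 0" "s\<^sup>2 = (\<bar>B\<bar> + 1) / \<epsilon>" using \<open>\<epsilon> > 0\<close> by (auto simp: s_def)
  have "measure (\<mu> n) {- s<..s} > 1 - \<epsilon>" for n
  proof -
    interpret real_distribution "\<mu> n" by (rule \<mu>)
    have "prob (- {- s<..s}) \<le> prob {x \<in> space (\<mu> n). s\<^sup>2 \<le> x\<^sup>2}"
      by (intro finite_measure_mono) (use s(1) in \<open>auto simp: abs_le_square_iff[symmetric]\<close>)
    also have "\<dots> \<le> (\<integral>x. x\<^sup>2 \<partial>\<mu> n) / s\<^sup>2"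
      using s(1) int by (intro integral_Markov_inequality_measure[where A = "{}"]) auto
    also have "\<dots> \<le> B / s\<^sup>2" using bdd by (intro divide_right_mono) auto
    also have "\<dots> < \<epsilon>" using \<open>\<epsilon> > 0\<close> by (simp add: s(2) field_simps abs_if)
    finally show ?thesis
      using prob_compl[of "{- s<..s}"] by (simp add: Compl_eq_Diff_UNIV)
  qed
  then show "\<exists>a b. a < b \<and> (\<forall>n. 1 - \<epsilon> < measure (\<mu> n) {a<..b})"
    using s(1) by (intro exI[of _ "- s"] exI[of _ s]) auto
qed

text \<open>The two characteristic functions share their Taylor polynomials at \<open>0\<close>, and
  \<open>growth\<close> sends the remainders to zero for every real \<open>t\<close>, so they agree
  everywhere.\<close>

lemma moments_determine_distribution:
  assumes M: "real_distribution M" "\<And>r. has_bochner_integral M (\<lambda>x. x ^ r) (m r)"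
    and M': "real_distribution M'" "\<And>r. has_bochner_integral M' (\<lambda>x. x ^ r) (m r)"
    and growth: "\<And>t. (\<lambda>r. t ^ r * m r / fact r) \<longlonglongrightarrow> 0"
  shows "M = M'"
proof (rule Levy_uniqueness[OF M(1) M'(1)], rule ext)
  fix t :: real
  define T where "T n = (\<Sum>k\<le>n. (\<i> * complex_of_real t) ^ k / fact k * complex_of_real (m k))" for n
  \<comment> \<open>Even orders are used because the remainder involves an absolute moment, which is
    then \<open>m (2 * n)\<close> itself.\<close>
  have approx: "cmod (char N t - T (2 * n)) \<le> 2 * (\<bar>t\<bar> ^ (2 * n) * m (2 * n) / fact (2 * n))"
    if "real_distribution N" "\<And>r. has_bochner_integral N (\<lambda>x. x ^ r) (m r)" for N n
  proof -
    interpret real_distribution N by fact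
    have *: "integrable N (\<lambda>x. x ^ r)" "(\<integral>x. x ^ r \<partial>N) = m r" for r
      using that(2) by (auto simp: has_bochner_integral_iff)
    show ?thesis
      using char_approx1[of "2 * n" t, OF *(1)] *(2)[of "2 * n"]
      by (simp add: *(2) T_def mult.assoc power_even_abs)
  qed
  have "cmod (char M t - char M' t) \<le> 4 * (\<bar>t\<bar> ^ (2 * n) * m (2 * n) / fact (2 * n))" for n
    using norm_triangle_ineq4[of "char M t - T (2 * n)" "char M' t - T (2 * n)"]
      approx[OF M, of n] approx[OF M', of n] by simp
  moreover have "(\<lambda>n. 4 * (\<bar>t\<bar> ^ (2 * n) * m (2 * n) / fact (2 * n))) \<longlonglongrightarrow> 4 * 0"
    using LIMSEQ_subseq_LIMSEQ[OF growth[of "\<bar>t\<bar>"], of "\<lambda>n. 2 * n"]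
    by (intro tendsto_mult_left) (simp add: strict_mono_def o_def)
  ultimately have "cmod (char M t - char M' t) \<le> 4 * 0"
    by (intro LIMSEQ_le_const) auto
  then show "char M t = char M' t" by simp
qed

text \<open>Bounded second moments give tightness. Every weak limit of a subsequence has the moments
  \<open>m\<close>, hence all these limits coincide, and a tight sequence with a single
  subsequential limit converges to it.\<close>

theorem method_of_moments:
  assumes \<mu>: "\<And>n. real_distribution (\<mu> n)"
    and int: "\<And>n r. integrable (\<mu> n) (\<lambda>x. x ^ r)"
    and lim: "\<And>r. (\<lambda>n. \<integral>x. x ^ r \<partial>\<mu> n) \<longlonglongrightarrow> m r"
    and growth: "\<And>t. (\<lambda>r. t ^ r * m r / fact r) \<longlonglongrightarrow> 0"
  obtains M where "real_distribution M" "\<And>r. has_bochner_integral M (\<lambda>x. x ^ r) (m r)"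
    "weak_conv_m \<mu> M"
proof -
  obtain B where "\<And>n. norm (\<integral>x. x\<^sup>2 \<partial>\<mu> n) \<le> B"
    using convergentI[OF lim[of 2], THEN convergent_imp_Bseq] by (auto simp: Bseq_def)
  then have "(\<integral>x. x\<^sup>2 \<partial>\<mu> n) \<le> B" for n
    by (metis abs_le_iff real_norm_def)
  then have tight: "tight \<mu>"
    by (intro tight_if_second_moments_bounded \<mu> int)
  have sub: "has_bochner_integral \<nu> (\<lambda>x. x ^ r) (m r)"
    if "strict_mono s" "real_distribution \<nu>" "weak_conv_m (\<mu> \<circ> s) \<nu>" for s \<nu> r
  proof (rule weak_conv_has_moments[OF _ that(2,3)])
    show "(\<lambda>n. \<integral>x. x ^ r \<partial>(\<mu> \<circ> s) n) \<longlonglongrightarrow> m r" for r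
      using LIMSEQ_subseq_LIMSEQ[OF lim that(1)] by (simp add: o_def)
  qed (use \<mu> int in auto)
  \<comment> \<open>The limit law arises here, as a weak limit along some subsequence.\<close>
  obtain s M where s: "strict_mono (s :: nat \<Rightarrow> nat)" "real_distribution M" "weak_conv_m (\<mu> \<circ> id \<circ> s) M"
    using tight_imp_convergent_subsubsequence[OF tight strict_mono_id] by blast
  have M: "has_bochner_integral M (\<lambda>x. x ^ r) (m r)" for r
    using sub[of s M] s by simp
  have "weak_conv_m \<mu> M"
  proof (rule tight_subseq_weak_converge[OF \<mu> s(2) tight])
    fix s' \<nu> assume "strict_mono s'" and \<nu>: "real_distribution \<nu>" and "weak_conv_m (\<mu> \<circ> s') \<nu>"
    then have "\<nu> = M"
      by (intro moments_determine_distribution[OF \<nu> sub s(2) M growth])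
    then show "weak_conv_m (\<mu> \<circ> s') M" using \<open>weak_conv_m (\<mu> \<circ> s') \<nu>\<close> by simp
  qed
  then show thesis using that s(2) M by blast
qed

section \<open>Growth of the Mittag-Leffler moments and conclusion\<close>

text \<open>This is the growth condition of \<open>method_of_moments\<close> after
  \<open>fact r\<close> has cancelled. The proof compares with the terms of the exponential series
  at index \<open>\<lfloor>r p\<rfloor>\<close>.\<close>

lemma power_over_Gamma_tendsto_0:
  fixes p t :: real
  assumes "p > 0"
  shows "(\<lambda>r. t ^ r / Gamma (real r * p + 1)) \<longlonglongrightarrow> 0"
proof -
  \<comment> \<open>Since \<open>r \<le> (k r + 1) / p\<close> and \<open>T \<ge> 1\<close>, the
    power \<open>T ^ r\<close> is at most \<open>S ^ (k r + 1)\<close> for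
    \<open>S = T powr (1 / p)\<close>.\<close>
  define T where "T = max 1 \<bar>t\<bar>"
  define S where "S = T powr (1 / p)"
  define k where "k r = nat \<lfloor>real r * p\<rfloor>" for r
  have T: "T \<ge> 1" "\<bar>t\<bar> \<le> T" by (auto simp: T_def)
  have k_lim: "filterlim k at_top sequentially"
    unfolding k_def using assms
    by (intro filterlim_compose[OF filterlim_nat_sequentially]
        filterlim_compose[OF filterlim_floor_sequentially]
        filterlim_at_top_mult_tendsto_pos[OF tendsto_const] filterlim_real_sequentially)
  have "(\<lambda>n. S ^ n / fact n) \<longlonglongrightarrow> 0"
    using summable_LIMSEQ_zero[OF summable_exp[of S]] by (simp add: divide_inverse mult.commute)
  then have "(\<lambda>r. S * (S ^ k r / fact (k r))) \<longlonglongrightarrow> S * 0"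
    by (intro tendsto_mult_left filterlim_compose[OF _ k_lim])
  then have lim: "(\<lambda>r. S * (S ^ k r / fact (k r))) \<longlonglongrightarrow> 0" by simp
  \<comment> \<open>\<open>Gamma\<close> is not increasing near \<open>1\<close>; this moves both
    arguments to at least \<open>2\<close>, where it is.\<close>
  have "\<forall>\<^sub>F r in sequentially. k r \<ge> 1"
    using k_lim by (auto simp: filterlim_at_top)
  then have "\<forall>\<^sub>F r in sequentially. norm (t ^ r / Gamma (real r * p + 1)) \<le> S * (S ^ k r / fact (k r))"
  proof eventually_elim
    case (elim r)
    have k: "real (k r) \<le> real r * p" "real r * p \<le> real (k r) + 1"
      using assms unfolding k_def by (auto simp: of_nat_floor)
    have "fact (k r) = Gamma (real (k r) + 1)" by (simp add: Gamma_fact add.commute)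
    also have "\<dots> \<le> Gamma (real r * p + 1)"
      using k(1) elim Gamma_real_strict_mono[of "real (k r) + 1" "real r * p + 1"]
      by (cases "real (k r) = real r * p") auto
    finally have Gamma: "fact (k r) \<le> Gamma (real r * p + 1)" .
    have "\<bar>t\<bar> ^ r \<le> T ^ r" using T by (intro power_mono) auto
    also have "\<dots> = T powr real r" using T by (simp add: powr_realpow)
    also have "\<dots> \<le> T powr (1 / p * (real (k r) + 1))"
      using T k(2) assms by (intro powr_mono) (auto simp: field_simps)
    also have "\<dots> = S powr (real (k r) + 1)"
      by (simp add: S_def powr_powr)
    also have "\<dots> = S * S ^ k r"
      using T by (simp add: S_def powr_add powr_realpow)
    finally have "\<bar>t\<bar> ^ r \<le> S * S ^ k r" .
    then have "\<bar>t\<bar> ^ r / Gamma (real r * p + 1) \<le> S * S ^ k r / fact (k r)"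
      using Gamma by (intro frac_le) (auto simp: S_def)
    moreover have "Gamma (real r * p + 1) > 0"
      using Gamma fact_gt_zero by (rule less_le_trans[rotated])
    ultimately show ?case by (simp add: power_abs)
  qed
  then show ?thesis using lim by (rule Lim_null_comparison)
qed

theorem theorem1:
  fixes p :: real and D :: "sp_network \<Rightarrow> nat"
  assumes "0 < p" and "p < 1"
    and "D \<in> {source_degree, sink_degree}"
  shows "(\<forall>n m. 1 \<le> m \<and> m \<le> n \<longrightarrow>
            measure_pmf.prob (bernoulli_network p n) {N. D N = m} =
              (\<Sum>j = 0..m - 1. real ((m - 1) choose j) * (-1) ^ (n + j - 1) *
                 ((p * (real j + 1) - 1) gchoose (n - 1))))
         \<and> (\<exists>M. mittag_leffler p M \<and>
              weak_conv_m
                (\<lambda>n. distr (measure_pmf (bernoulli_network p n)) borel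
                        (\<lambda>N. real (D N) / real n powr p)) M)"
proof (intro conjI allI impI)
  have p: "0 \<le> p" "p \<le> 1" using assms by auto
  \<comment> \<open>Size \<open>0\<close> is covered too, as it has the same network as size
    \<open>1\<close> and \<open>n - 1\<close> is truncated.\<close>
  have law: "map_pmf D (bernoulli_network p n) = degree_law p (n - 1)" for n
    using map_pmf_degree_bernoulli_network[OF assms(3) p, of "n - 1"]
    by (simp add: bernoulli_network_def)
  {
    fix n m :: nat
    assume "1 \<le> m \<and> m \<le> n"
    then obtain k l where kl: "n = Suc k" "m = Suc l"
      by (metis Suc_le_D One_nat_def le_trans)
    have "measure_pmf.prob (bernoulli_network p n) {N. D N = m} =
        pmf (map_pmf D (bernoulli_network p n)) m"
      by (simp add: pmf_map vimage_def)
    also have "\<dots> = (\<Sum>j = 0..m - 1. real ((m - 1) choose j) * (-1) ^ (n + j - 1) *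
        ((p * (real j + 1) - 1) gchoose (n - 1)))"
      unfolding law using pmf_degree_law[OF p, of k l] by (simp add: kl atLeast0AtMost)
    finally show "measure_pmf.prob (bernoulli_network p n) {N. D N = m} =
        (\<Sum>j = 0..m - 1. real ((m - 1) choose j) * (-1) ^ (n + j - 1) *
          ((p * (real j + 1) - 1) gchoose (n - 1)))" .
  }
  define \<mu> where "\<mu> n = distr (measure_pmf (bernoulli_network p n)) borel
      (\<lambda>N. real (D N) / real n powr p)" for n
  have \<mu>_law: "\<mu> n = distr (measure_pmf (degree_law p (n - 1))) borel
      (\<lambda>d. real d / real n powr p)" for n
    unfolding law[symmetric] map_pmf_rep_eq \<mu>_def by (subst distr_distr) (auto simp: o_def)
  have \<mu>: "real_distribution (\<mu> n)" for n
    unfolding \<mu>_def real_distribution_def real_distribution_axioms_def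
    by (auto intro!: measure_pmf.prob_space_distr)
  have int: "integrable (\<mu> n) (\<lambda>x. x ^ r)" for n r
    unfolding \<mu>_law by (subst integrable_distr_eq) auto
  have lim: "(\<lambda>n. \<integral>x. x ^ r \<partial>\<mu> n) \<longlonglongrightarrow> fact r / Gamma (real r * p + 1)" for r
    unfolding \<mu>_law using moments_degree_law_tendsto[OF assms(1) p(2), of r]
    by (subst integral_distr) auto
  have growth: "(\<lambda>r. t ^ r * (fact r / Gamma (real r * p + 1)) / fact r) \<longlonglongrightarrow> 0" for t
    using power_over_Gamma_tendsto_0[OF assms(1), of t] by simp
  obtain M where "real_distribution M"
      "\<And>r. has_bochner_integral M (\<lambda>x. x ^ r) (fact r / Gamma (real r * p + 1))" "weak_conv_m \<mu> M"
    using method_of_moments[OF \<mu> int lim growth] by blast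
  then show "\<exists>M. mittag_leffler p M \<and> weak_conv_m (\<lambda>n. distr (measure_pmf (bernoulli_network p n))
      borel (\<lambda>N. real (D N) / real n powr p)) M"
    unfolding mittag_leffler_def \<mu>_def by blast
qed

end
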